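(* Let $F\subset\mathbb{R}^2$ be a fractal necklace, not reduced to a single point, with a necklace iterated function system $\{f_1,\dots,f_n\}$ on $\mathbb{R}^2$. If $F$ has no cut points, then $\{f_1,\dots,f_n\}$ satisfies the open set condition.
   Context: Let $I=\{1,2,\dots,n\}$. For $k\in I$ let $f_k:\mathbb{R}^2\to\mathbb{R}^2$ be contractive, i.e. $|f_k(x)-f_k(y)|\le c_k|x-y|$ for all $x,y$, with some $c_k\in(0,1)$. The attractor of the iterated function system (IFS) $\{f_1,\dots,f_n\}$ is the unique nonempty compact set $F\subset\mathbb{R}^2$ with $F=\bigcup_{k=1}^n f_k(F)$. Fractal necklace: $F$ is called a (fractal) necklace, and the ordered family $\{f_1,\dots,f_n\}$ a necklace IFS, if $n\ge3$, every $f_k$ is a contractive homeomorphism of $\mathbb{R}^2$ onto itself, and for each pair of distinct $m,k\in I$: $f_m(F)\cap f_k(F)$ is a singleton if $|m-k|=1$ or $|m-k|=n-1$, and $f_m(F)\cap f_k(F)=\emptyset$ if $2\le|m-k|\le n-2$. (The maps $f_k$ are not assumed to be similitudes or affine.) Open set condition (OSC): there is a nonempty bounded open set $V\subset\mathbb{R}^2$ such that $f_1(V),\dots,f_n(V)$ are pairwise disjoint open subsets of $V$. Cut point: a point $x$ of a connected topological space $X$ is a cut point of $X$ if $X\setminus\{x\}$ is not connected. (Every fractal necklace is connected.) *)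

theory Defs
  imports "HOL-Analysis.Analysis"
begin

text \<open>A family \<open>f\<^sub>1, \<dots>, f\<^sub>n\<close> of self-maps is a function \<open>f\<close> on \<^typ>\<open>nat\<close>
  of which only the values at the indices in \<open>{1..n}\<close> are relevant.\<close>

definition contractive :: "('a::metric_space \<Rightarrow> 'a) \<Rightarrow> bool" where
  "contractive g \<longleftrightarrow> (\<exists>c. 0 < c \<and> c < 1 \<and> (\<forall>x y. dist (g x) (g y) \<le> c * dist x y))"

text \<open>For contractive maps on a nonempty complete space and \<open>n \<ge> 1\<close>, exactly one
  set satisfies the following predicate.\<close>

definition is_attractor :: "nat \<Rightarrow> (nat \<Rightarrow> 'a::metric_space \<Rightarrow> 'a) \<Rightarrow> 'a set \<Rightarrow> bool" where
  "is_attractor n f F \<longleftrightarrow> F \<noteq> {} \<and> compact F \<and> F = (\<Union>k\<in>{1..n}. f k ` F)"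

text \<open>Index differences are taken in \<^typ>\<open>int\<close> to avoid truncated subtraction.\<close>

definition fractal_necklace ::
    "nat \<Rightarrow> (nat \<Rightarrow> real^2 \<Rightarrow> real^2) \<Rightarrow> (real^2) set \<Rightarrow> bool" where
  "fractal_necklace n f F \<longleftrightarrow>
     n \<ge> 3 \<and>
     (\<forall>k\<in>{1..n}. contractive (f k) \<and> (\<exists>g. homeomorphism UNIV UNIV (f k) g)) \<and>
     is_attractor n f F \<and>
     (\<forall>m\<in>{1..n}. \<forall>k\<in>{1..n}. m \<noteq> k \<longrightarrow>
        (\<bar>int m - int k\<bar> = 1 \<or> \<bar>int m - int k\<bar> = int n - 1 \<longrightarrow>
           is_singleton (f m ` F \<inter> f k ` F)) \<and>
        (2 \<le> \<bar>int m - int k\<bar> \<and> \<bar>int m - int k\<bar> \<le> int n - 2 \<longrightarrow>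
           f m ` F \<inter> f k ` F = {}))"

definition open_set_condition ::
    "nat \<Rightarrow> (nat \<Rightarrow> 'a::metric_space \<Rightarrow> 'a) \<Rightarrow> bool" where
  "open_set_condition n f \<longleftrightarrow>
     (\<exists>V. V \<noteq> {} \<and> bounded V \<and> open V \<and>
          (\<forall>k\<in>{1..n}. open (f k ` V) \<and> f k ` V \<subseteq> V) \<and>
          disjoint_family_on (\<lambda>k. f k ` V) {1..n})"

text \<open>Only meant for connected \<open>S\<close>, a condition every fractal necklace satisfies.\<close>

definition cut_point :: "'a::topological_space set \<Rightarrow> 'a \<Rightarrow> bool" where
  "cut_point S x \<longleftrightarrow> x \<in> S \<and> \<not> connected (S - {x})"

end

theory Submission
  imports Defs
begin

text \<open>
  The open set is \<open>V = inside F\<close>, the union of the bounded components of the complement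
  of \<open>F\<close>. A homeomorphism of the plane preserves boundedness in both directions, so it
  commutes with \<^const>\<open>inside\<close>, and \<open>f k ` V = inside (f k ` F)\<close>. Call \<open>f k ` F\<close> the
  \<open>k\<close>-th bead.

  The key fact is that \<open>F\<close> does not enter the inside of any of its beads
  (\<open>necklace_avoids_inside_piece\<close>). Since \<open>F\<close> has no cut points, no bead, being a
  homeomorphic copy of \<open>F\<close>, is disconnected by the removal of a point, and no point lies on
  three beads. Hence \<open>F\<close> with one bead taken away is still a connected chain, so it
  lies wholly inside or wholly outside of that bead. If it were inside, then \<open>F\<close> and its bead
  would have the same outside, and the contraction \<open>f k\<close> would map the bounded set
  \<open>- outside F\<close> onto itself, which is impossible unless \<open>F\<close> is a single point.

  It follows that \<open>inside (f k ` F)\<close> is disjoint from \<open>F\<close> and therefore contained in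
  \<open>V\<close>, and that two beads have disjoint insides: a common point would lie in a bounded
  component of both complements, whose frontier would be contained in both beads, hence in one
  point, and one point does not separate the plane (\<open>insides_disjoint\<close>).

  Finally, \<open>V\<close> is nonempty because the necklace closes up: the first bead and the union of
  the others are continua whose intersection consists of two distinct contact points, and by Janiszewski's theorem the union of two continua with disconnected
  intersection separates the plane (\<open>necklace_inside_nonempty\<close>).
\<close>

section \<open>Separation of Euclidean space by compact sets\<close>

text \<open>Bounded sets are those contained in compact sets, which makes boundedness a topological
  notion for homeomorphisms of the whole space.\<close>
lemma homeomorphism_image_bounded_iff:
  fixes h :: "'a::euclidean_space \<Rightarrow> 'a"
  assumes "homeomorphism UNIV UNIV h g"
  shows "bounded (h ` T) \<longleftrightarrow> bounded T"
proof -
  have *: "bounded (u ` S)" if "continuous_on UNIV u" "bounded S" for u :: "'a \<Rightarrow> 'a" and S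
  proof -
    have "compact (u ` closure S)"
      by (rule compact_continuous_image[OF continuous_on_subset[OF that(1)]]) (auto simp: that)
    then show ?thesis
      by (meson bounded_subset closure_subset compact_imp_bounded image_mono)
  qed
  have "g ` h ` T = T"
    using assms by (force simp: homeomorphism_def image_comp)
  then show ?thesis
    using *[of h T] *[of g "h ` T"] assms by (auto simp: homeomorphism_def)
qed

lemma homeomorphism_bij:
  assumes "homeomorphism UNIV UNIV h g"
  shows "bij h"
  using assms by (metis (full_types) UNIV_I bij_def homeomorphism_def inj_on_inverseI)

lemma homeomorphism_UNIV_restrict:
  assumes "homeomorphism UNIV UNIV h g"
  shows "homeomorphism S (h ` S) h g"
  using homeomorphism_of_subsets[OF assms] by blast

lemma
  fixes h :: "'a::euclidean_space \<Rightarrow> 'a"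
  assumes h: "homeomorphism UNIV UNIV h g"
  shows inside_homeomorphism_image: "inside (h ` S) = h ` inside S"
    and outside_homeomorphism_image: "outside (h ` S) = h ` outside S"
proof -
  have bij: "bij h" using homeomorphism_bij[OF h] .
  have compl: "- h ` S = h ` (- S)"
    using bij by (simp add: bij_image_Compl_eq)
  have comp: "connected_component_set (- h ` S) (h x) = h ` connected_component_set (- S) x"
    if "x \<notin> S" for x
    unfolding compl
    by (rule connected_component_set_homeomorphism[OF homeomorphism_UNIV_restrict[OF h]])
      (use that in auto)
  have ins: "h x \<in> inside (h ` S) \<longleftrightarrow> x \<in> inside S" for x
  proof (cases "x \<in> S")
    case True
    then show ?thesis by (auto simp: inside_def)
  next
    case False
    moreover have "h x \<notin> h ` S" using False bij by (simp add: bij_is_inj inj_image_mem_iff)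
    ultimately show ?thesis
      by (simp add: inside_def comp homeomorphism_image_bounded_iff[OF h])
  qed
  show 1: "inside (h ` S) = h ` inside S"
  proof (intro set_eqI)
    fix y
    obtain x where "y = h x" using bij by (metis bij_pointE)
    then show "y \<in> inside (h ` S) \<longleftrightarrow> y \<in> h ` inside S"
      using ins[of x] bij by (simp add: bij_is_inj inj_image_mem_iff)
  qed
  show "outside (h ` S) = h ` outside S"
    by (simp only: outside_inside 1 bij_image_Compl_eq[OF bij] image_Un)
qed

text \<open>If neither set enters the inside of the other, then a component of one complement that meets
  both insides is also a component of the other complement. Its frontier then lies in the finite
  set \<open>A \<inter> B\<close>, which cannot enclose a bounded set in dimension at least two.\<close>
lemma insides_disjoint:
  fixes A B :: "'a::euclidean_space set"
  assumes dim: "2 \<le> DIM('a)" and "closed A" "closed B" and fin: "finite (A \<inter> B)"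
    and AB: "A \<inter> inside B = {}" and BA: "B \<inter> inside A = {}"
  shows "inside A \<inter> inside B = {}"
proof (rule ccontr)
  assume "inside A \<inter> inside B \<noteq> {}"
  then obtain x where x: "x \<in> inside A" "x \<in> inside B" by blast
  have sub: "connected_component_set (- S) x \<subseteq> connected_component_set (- T) x"
    if "x \<in> inside S" "T \<inter> inside S = {}" for S T
  proof (rule connected_component_maximal)
    show "x \<in> connected_component_set (- S) x"
      using that(1) by (auto simp: inside_def)
    have "connected_component_set (- S) x \<subseteq> inside S"
      using that(1) inside_same_component by blast
    then show "connected_component_set (- S) x \<subseteq> - T"
      using that(2) by blast
  qed simp
  define D where "D = connected_component_set (- A) x"
  have D: "D = connected_component_set (- B) x"
    unfolding D_def using sub[of A B] sub[of B A] x AB BA by blast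
  have "x \<in> D" using x by (auto simp: D_def inside_def)
  have "bounded D" using x by (auto simp: D_def inside_def)
  have "frontier D \<subseteq> A"
    using frontier_of_connected_component_subset[of "- A" x] frontier_subset_closed[OF \<open>closed A\<close>]
    by (auto simp: D_def)
  moreover have "frontier D \<subseteq> B"
    using frontier_of_connected_component_subset[of "- B" x] frontier_subset_closed[OF \<open>closed B\<close>]
    by (auto simp: D)
  ultimately have front: "frontier D \<subseteq> A \<inter> B" by blast
  have "connected (- (A \<inter> B))"
    using fin
    by (intro path_connected_imp_connected path_connected_complement_countable[OF dim] countable_finite)
  moreover have "- (A \<inter> B) \<inter> D \<noteq> {}"
    using \<open>x \<in> D\<close> connected_component_subset[of "- A" x] by (auto simp: D_def)
  moreover have "- (A \<inter> B) - D \<noteq> {}"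
  proof
    assume "- (A \<inter> B) - D = {}"
    then have "UNIV = (A \<inter> B) \<union> D" by blast
    moreover have "bounded ((A \<inter> B) \<union> D)"
      using fin \<open>bounded D\<close> by (simp add: finite_imp_bounded)
    ultimately show False
      using not_bounded_UNIV by metis
  qed
  ultimately show False
    using connected_Int_frontier[of "- (A \<inter> B)" D] front by blast
qed

text \<open>The complex version \<open>Janiszewski_dual\<close>, transported along a linear isometry.\<close>
lemma Janiszewski_dual_plane:
  fixes S T :: "'a::euclidean_space set"
  assumes dim: "DIM('a) = 2"
    and "compact S" "compact T" "connected S" "connected T" "connected (- (S \<union> T))"
  shows "connected (S \<inter> T)"
proof -
  obtain h :: "'a \<Rightarrow> complex" and g where hg: "linear h" "linear g"
    "\<And>x. norm (h x) = norm x" "\<And>y. norm (g y) = norm y" "\<And>x. g (h x) = x" "\<And>y. h (g y) = y"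
    using isomorphisms_UNIV_UNIV[where 'M='a and 'N=complex] dim by auto
  have ch: "continuous_on X h" and cg: "continuous_on Y g" for X Y
    using hg by (simp_all add: linear_continuous_on linear_conv_bounded_linear)
  have bij: "bij h" using hg by (metis bijI')
  have "connected (h ` S \<inter> h ` T)"
  proof (rule Janiszewski_dual)
    have "- (h ` S \<union> h ` T) = h ` (- (S \<union> T))"
      by (simp only: bij_image_Compl_eq[OF bij] image_Un)
    then show "connected (- (h ` S \<union> h ` T))"
      using assms ch by (simp add: connected_continuous_image)
  qed (use assms ch in \<open>auto intro: compact_continuous_image connected_continuous_image\<close>)
  then have "connected (g ` (h ` S \<inter> h ` T))"
    using cg by (blast intro: connected_continuous_image)
  moreover have "g ` (h ` S \<inter> h ` T) = S \<inter> T"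
    using bij hg by (simp add: bij_is_inj flip: image_Int add: image_comp)
  ultimately show ?thesis by simp
qed

section \<open>Connectedness\<close>

text \<open>Two of the connected sets \<open>S - {x}\<close> cover \<open>S\<close>, and they overlap because \<open>S\<close> has a third
  point. Two-point spaces show that some bound on the size of \<open>S\<close> is necessary.\<close>
lemma connected_if_no_point_disconnects:
  assumes "infinite S" and "\<And>x. x \<in> S \<Longrightarrow> connected (S - {x})"
  shows "connected S"
proof -
  obtain T where T: "T \<subseteq> S" "finite T" "card T = 3"
    using infinite_arbitrarily_large[OF assms(1)] by blast
  then obtain x y z where "T = {x, y, z}" "x \<noteq> y" "x \<noteq> z" "y \<noteq> z"
    by (metis card_3_iff)
  then have xyz: "x \<in> S" "y \<in> S" "z \<in> S" "x \<noteq> y" "x \<noteq> z" "y \<noteq> z"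
    using T by auto
  have "connected ((S - {x}) \<union> (S - {y}))"
    by (rule connected_Un) (use assms xyz in auto)
  moreover have "(S - {x}) \<union> (S - {y}) = S"
    using xyz by blast
  ultimately show ?thesis by simp
qed

lemma connected_UN_consecutive:
  fixes G :: "nat \<Rightarrow> 'a::topological_space set"
  assumes "\<And>j. a \<le> j \<Longrightarrow> j \<le> b \<Longrightarrow> connected (G j)"
    and "\<And>j. a \<le> j \<Longrightarrow> j < b \<Longrightarrow> G j \<inter> G (Suc j) \<noteq> {}"
  shows "connected (\<Union>j\<in>{a..b}. G j)"
  using assms
proof (induction b)
  case 0
  then show ?case by (cases "a = 0") auto
next
  case (Suc b)
  show ?case
  proof (cases "a \<le> b")
    case True
    have "connected ((\<Union>j\<in>{a..b}. G j) \<union> G (Suc b))"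
    proof (rule connected_Un)
      have "G b \<inter> G (Suc b) \<noteq> {}" using Suc.prems(2) True by simp
      then show "(\<Union>j\<in>{a..b}. G j) \<inter> G (Suc b) \<noteq> {}" using True by fastforce
    qed (use Suc True in auto)
    then show ?thesis
      using True by (simp add: atLeastAtMostSuc_conv Un_commute)
  next
    case False
    then have "{a..Suc b} = (if a = Suc b then {Suc b} else {})" by auto
    then show ?thesis using Suc.prems(1) by auto
  qed
qed

text \<open>Cutting a cycle of sets at index \<open>k\<close> leaves the two chains below and above \<open>k\<close>. When both
  are nonempty, they are joined by the link between the indices \<open>n\<close> and \<open>1\<close>.\<close>
lemma connected_UN_cycle_minus_one:
  fixes G :: "nat \<Rightarrow> 'a::topological_space set"
  assumes k: "k \<in> {1..n}"
    and conn: "\<And>j. j \<in> {1..n} - {k} \<Longrightarrow> connected (G j)"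
    and meet: "\<And>j. j \<in> {1..<n} \<Longrightarrow> j \<noteq> k \<Longrightarrow> Suc j \<noteq> k \<Longrightarrow> G j \<inter> G (Suc j) \<noteq> {}"
    and wrap: "1 \<noteq> k \<Longrightarrow> n \<noteq> k \<Longrightarrow> G n \<inter> G 1 \<noteq> {}"
  shows "connected (\<Union>j\<in>{1..n} - {k}. G j)"
proof -
  have low: "connected (\<Union>j\<in>{1..k-1}. G j)"
  proof (rule connected_UN_consecutive)
    show "connected (G j)" if "1 \<le> j" "j \<le> k - 1" for j
      by (rule conn) (use that k in auto)
    show "G j \<inter> G (Suc j) \<noteq> {}" if "1 \<le> j" "j < k - 1" for j
      by (rule meet) (use that k in auto)
  qed
  have high: "connected (\<Union>j\<in>{Suc k..n}. G j)"
  proof (rule connected_UN_consecutive)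
    show "connected (G j)" if "Suc k \<le> j" "j \<le> n" for j
      by (rule conn) (use that k in auto)
    show "G j \<inter> G (Suc j) \<noteq> {}" if "Suc k \<le> j" "j < n" for j
      by (rule meet) (use that k in auto)
  qed
  have split: "{1..n} - {k} = {1..k-1} \<union> {Suc k..n}"
    using k by auto
  show ?thesis
  proof (cases "k = 1 \<or> k = n")
    case True
    then have "{1..n} - {k} = {Suc k..n} \<or> {1..n} - {k} = {1..k-1}"
      using k by auto
    then show ?thesis using low high by metis
  next
    case False
    then have "1 \<in> {1..k-1}" "n \<in> {Suc k..n}"
      using k by auto
    moreover have "G n \<inter> G 1 \<noteq> {}"
      by (rule wrap) (use False in auto)
    ultimately have "(\<Union>j\<in>{1..k-1}. G j) \<inter> (\<Union>j\<in>{Suc k..n}. G j) \<noteq> {}"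
      by blast
    then show ?thesis
      unfolding split UN_Un using low high connected_Un by blast
  qed
qed

section \<open>The beads of a necklace\<close>

lemma necklace_homeomorphism:
  assumes "fractal_necklace n f F" "k \<in> {1..n}"
  obtains g where "homeomorphism UNIV UNIV (f k) g"
  using assms unfolding fractal_necklace_def by blast

lemma necklace_attractor:
  assumes "fractal_necklace n f F"
  shows "F \<noteq> {}" "compact F" "F = (\<Union>k\<in>{1..n}. f k ` F)" "3 \<le> n"
  using assms unfolding fractal_necklace_def is_attractor_def by blast+

lemma necklace_split:
  assumes "fractal_necklace n f F" "k \<in> {1..n}"
  shows "F = f k ` F \<union> (\<Union>j\<in>{1..n}-{k}. f j ` F)"
  using necklace_attractor(3)[OF assms(1)] insert_Diff[OF assms(2)] by (metis UN_insert)

lemma necklace_piece: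
  assumes "fractal_necklace n f F" "k \<in> {1..n}"
  shows "compact (f k ` F)" "f k ` F \<subseteq> F" "inj (f k)"
proof -
  obtain g where g: "homeomorphism UNIV UNIV (f k) g"
    using necklace_homeomorphism[OF assms] .
  show "compact (f k ` F)"
    using homeomorphism_UNIV_restrict[OF g] necklace_attractor(2)[OF assms(1)]
    by (meson compact_continuous_image homeomorphism_cont1)
  show "f k ` F \<subseteq> F"
    using necklace_attractor(3)[OF assms(1)] assms(2) by blast
  show "inj (f k)"
    using homeomorphism_bij[OF g] by (rule bij_is_inj)
qed

lemma necklace_adjacent:
  assumes "fractal_necklace n f F" "m \<in> {1..n}" "k \<in> {1..n}" "m \<noteq> k"
    and "\<bar>int m - int k\<bar> = 1 \<or> \<bar>int m - int k\<bar> = int n - 1"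
  obtains p where "f m ` F \<inter> f k ` F = {p}"
  using assms unfolding fractal_necklace_def is_singleton_def by blast

lemma necklace_meet_cases:
  assumes "fractal_necklace n f F" "m \<in> {1..n}" "k \<in> {1..n}" "m \<noteq> k"
  shows "f m ` F \<inter> f k ` F = {} \<or>
    (\<bar>int m - int k\<bar> = 1 \<or> \<bar>int m - int k\<bar> = int n - 1) \<and> (\<exists>p. f m ` F \<inter> f k ` F = {p})"
proof (cases "\<bar>int m - int k\<bar> = 1 \<or> \<bar>int m - int k\<bar> = int n - 1")
  case True
  then show ?thesis using necklace_adjacent[OF assms] by metis
next
  case False
  then have "2 \<le> \<bar>int m - int k\<bar> \<and> \<bar>int m - int k\<bar> \<le> int n - 2"
    using assms(2-4) by auto
  then show ?thesis
    using assms unfolding fractal_necklace_def by blast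
qed

text \<open>If \<open>F\<close> were finite, each bead would have as many points as \<open>F\<close> and hence be all of \<open>F\<close>,
  but adjacent beads share only one point.\<close>
lemma necklace_infinite:
  assumes N: "fractal_necklace n f F" and "\<not> is_singleton F"
  shows "infinite F"
proof
  assume "finite F"
  have all: "f k ` F = F" if "k \<in> {1..n}" for k
    using \<open>finite F\<close> necklace_piece[OF N that]
    by (metis card_image card_subset_eq inj_on_subset subset_UNIV)
  have "1 \<in> {1..n}" "2 \<in> {1..n}"
    using necklace_attractor(4)[OF N] by auto
  then obtain p where "f 1 ` F \<inter> f 2 ` F = {p}"
    using necklace_adjacent[OF N, of 1 2] by auto
  then show False
    using all \<open>1 \<in> {1..n}\<close> \<open>2 \<in> {1..n}\<close> \<open>\<not> is_singleton F\<close> by (auto simp: is_singleton_def)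
qed

section \<open>Necklaces without cut points\<close>

context
  fixes n :: nat and f :: "nat \<Rightarrow> real^2 \<Rightarrow> real^2" and F :: "(real^2) set"
  assumes N: "fractal_necklace n f F"
    and nontrivial: "\<not> is_singleton F"
    and no_cut: "\<nexists>x. cut_point F x"
begin

lemma piece_minus_point_connected:
  assumes "k \<in> {1..n}" "x \<in> f k ` F"
  shows "connected (f k ` F - {x})"
proof -
  obtain y where y: "y \<in> F" "x = f k y" using assms(2) by blast
  obtain g where "homeomorphism UNIV UNIV (f k) g"
    using necklace_homeomorphism[OF N assms(1)] .
  then have "continuous_on (F - {y}) (f k)"
    by (meson continuous_on_subset homeomorphism_cont1 subset_UNIV)
  moreover have "connected (F - {y})"
    using no_cut y by (auto simp: cut_point_def)
  moreover have "f k ` F - {x} = f k ` (F - {y})"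
    using necklace_piece(3)[OF N assms(1)] y by (auto simp: inj_def)
  ultimately show ?thesis
    by (simp add: connected_continuous_image)
qed

lemma piece_infinite:
  assumes "k \<in> {1..n}"
  shows "infinite (f k ` F)"
  using necklace_infinite[OF N nontrivial] necklace_piece(3)[OF N assms]
  by (metis finite_imageD inj_on_subset subset_UNIV)

lemma piece_connected:
  assumes "k \<in> {1..n}"
  shows "connected (f k ` F)"
  using connected_if_no_point_disconnects[OF piece_infinite[OF assms]]
    piece_minus_point_connected[OF assms] by blast

text \<open>Three mutually touching beads exist only for \<open>n = 3\<close>. If they touched in one point, that point
  would be all of the contact between one bead and the two others, and so a cut point of \<open>F\<close>.\<close>
lemma no_triple_point:
  assumes abc: "a \<in> {1..n}" "b \<in> {1..n}" "c \<in> {1..n}" "a \<noteq> b" "a \<noteq> c" "b \<noteq> c"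
  shows "f a ` F \<inter> f b ` F \<inter> f c ` F = {}"
proof (rule ccontr)
  assume "f a ` F \<inter> f b ` F \<inter> f c ` F \<noteq> {}"
  then obtain q where q: "q \<in> f a ` F" "q \<in> f b ` F" "q \<in> f c ` F" by blast
  have meet: "(\<bar>int i - int j\<bar> = 1 \<or> \<bar>int i - int j\<bar> = int n - 1) \<and> f i ` F \<inter> f j ` F = {q}"
    if "i \<in> {1..n}" "j \<in> {1..n}" "i \<noteq> j" "q \<in> f i ` F" "q \<in> f j ` F" for i j
  proof -
    have "q \<in> f i ` F \<inter> f j ` F" using that(4,5) by (rule IntI)
    then show ?thesis
      using necklace_meet_cases[OF N that(1-3)] by (metis empty_iff singletonD)
  qed
  have ab: "(\<bar>int a - int b\<bar> = 1 \<or> \<bar>int a - int b\<bar> = int n - 1) \<and> f a ` F \<inter> f b ` F = {q}"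
    and ac: "(\<bar>int a - int c\<bar> = 1 \<or> \<bar>int a - int c\<bar> = int n - 1) \<and> f a ` F \<inter> f c ` F = {q}"
    and bc: "(\<bar>int b - int c\<bar> = 1 \<or> \<bar>int b - int c\<bar> = int n - 1) \<and> f b ` F \<inter> f c ` F = {q}"
    by (rule meet[OF abc(1,2,4) q(1,2)], rule meet[OF abc(1,3,5) q(1,3)],
        rule meet[OF abc(2,3,6) q(2,3)])
  have "n = 3"
    using conjunct1[OF ab] conjunct1[OF ac] conjunct1[OF bc] abc necklace_attractor(4)[OF N]
    by auto
  then have "{1..n} = {a, b, c}"
    using abc by auto
  then have "F = (\<Union>i\<in>{a, b, c}. f i ` F)"
    using necklace_attractor(3)[OF N] by metis
  moreover have "(\<Union>i\<in>{a, b, c}. f i ` F) = f a ` F \<union> (f b ` F \<union> f c ` F)"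
    by simp
  ultimately have F: "F = f a ` F \<union> (f b ` F \<union> f c ` F)"
    by (rule trans)
  have "q \<in> F" using necklace_piece(2)[OF N abc(1)] q(1) by (rule subsetD)
  then have conn: "connected (F - {q})"
    using no_cut by (auto simp: cut_point_def)
  have "f a ` F \<inter> (F - {q}) = {} \<or> (f b ` F \<union> f c ` F) \<inter> (F - {q}) = {}"
  proof (rule connected_closedD[OF conn])
    have "f a ` F \<inter> (f b ` F \<union> f c ` F) = {q}"
      using ab ac by (simp add: Int_Un_distrib)
    then show "f a ` F \<inter> (f b ` F \<union> f c ` F) \<inter> (F - {q}) = {}" by blast
    show "F - {q} \<subseteq> f a ` F \<union> (f b ` F \<union> f c ` F)"
      by (rule subset_trans[OF Diff_subset equalityD1[OF F]])
  qed (use necklace_piece(1)[OF N] abc in \<open>simp_all add: compact_imp_closed closed_Un\<close>)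
  moreover have "f i ` F \<inter> (F - {q}) \<noteq> {}" if "i \<in> {1..n}" for i
  proof
    assume "f i ` F \<inter> (F - {q}) = {}"
    then have "f i ` F \<subseteq> {q}"
      using necklace_piece(2)[OF N that] by (metis Diff_eq_empty_iff Int_Diff inf.absorb1)
    then show False
      using piece_infinite[OF that] by (metis finite.emptyI finite_insert finite_subset)
  qed
  ultimately show False
    using abc by (metis Int_Un_distrib2 Un_empty)
qed

text \<open>The first claim serves to separate the plane by \<open>F\<close>, the second to place the rest of the
  necklace relative to the \<open>k\<close>-th bead. Removing this bead takes at most one point from each of
  the others, and does not remove their mutual contacts, since there are no triple points.\<close>
lemma other_pieces_connected:
  assumes k: "k \<in> {1..n}"
  shows "connected (\<Union>j\<in>{1..n}-{k}. f j ` F)"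
    and "connected (\<Union>j\<in>{1..n}-{k}. f j ` F - f k ` F)"
proof -
  have meet: "f i ` F \<inter> f j ` F - f k ` F \<noteq> {}"
    if ij: "i \<in> {1..n} - {k}" "j \<in> {1..n} - {k}" "i \<noteq> j"
      "\<bar>int i - int j\<bar> = 1 \<or> \<bar>int i - int j\<bar> = int n - 1" for i j
  proof -
    obtain p where "f i ` F \<inter> f j ` F = {p}"
      by (rule necklace_adjacent[OF N _ _ ij(3,4)]) (use ij in auto)
    moreover have "f i ` F \<inter> f j ` F \<inter> f k ` F = {}"
      by (rule no_triple_point) (use ij k in auto)
    ultimately show ?thesis by (metis Diff_triv insert_not_empty)
  qed
  have consecutive: "f j ` F \<inter> f (Suc j) ` F - f k ` F \<noteq> {}"
    if "j \<in> {1..<n}" "j \<noteq> k" "Suc j \<noteq> k" for j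
    by (rule meet) (use that in auto)
  have wrap: "f n ` F \<inter> f 1 ` F - f k ` F \<noteq> {}" if "1 \<noteq> k" "n \<noteq> k"
    by (rule meet) (use that k in auto)
  show "connected (\<Union>j\<in>{1..n}-{k}. f j ` F)"
  proof (rule connected_UN_cycle_minus_one[OF k])
    show "f j ` F \<inter> f (Suc j) ` F \<noteq> {}" if "j \<in> {1..<n}" "j \<noteq> k" "Suc j \<noteq> k" for j
      using consecutive[OF that] by (metis empty_Diff)
    show "f n ` F \<inter> f 1 ` F \<noteq> {}" if "1 \<noteq> k" "n \<noteq> k"
      using wrap[OF that] by (metis empty_Diff)
  qed (simp add: piece_connected)
  have diff_Int_diff: "(A - C) \<inter> (B - C) = A \<inter> B - C" for A B C :: "(real^2) set"
    by blast
  show "connected (\<Union>j\<in>{1..n}-{k}. f j ` F - f k ` F)"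
  proof (rule connected_UN_cycle_minus_one[OF k])
    show "connected (f j ` F - f k ` F)" if "j \<in> {1..n} - {k}" for j
    proof -
      have j: "j \<in> {1..n}" "j \<noteq> k" using that by auto
      consider "f j ` F \<inter> f k ` F = {}" | p where "f j ` F \<inter> f k ` F = {p}"
        using necklace_meet_cases[OF N j(1) k j(2)] by blast
      then show ?thesis
      proof cases
        case 1
        then show ?thesis using piece_connected[OF j(1)] by (simp add: Diff_triv)
      next
        case 2
        then have "f j ` F - f k ` F = f j ` F - {p}" "p \<in> f j ` F"
          by (metis Diff_Int Diff_cancel Un_empty_left, metis IntD1 insertI1)
        then show ?thesis using piece_minus_point_connected[OF j(1)] by simp
      qed
    qed
    show "(f j ` F - f k ` F) \<inter> (f (Suc j) ` F - f k ` F) \<noteq> {}"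
      if "j \<in> {1..<n}" "j \<noteq> k" "Suc j \<noteq> k" for j
      unfolding diff_Int_diff by (rule consecutive[OF that])
    show "(f n ` F - f k ` F) \<inter> (f 1 ` F - f k ` F) \<noteq> {}" if "1 \<noteq> k" "n \<noteq> k"
      unfolding diff_Int_diff by (rule wrap[OF that])
  qed
qed

text \<open>The rest of the necklace is connected, so if it entered the inside of a bead, it would be
  contained in it. That bead would then surround the whole necklace, against the fact that
  it is a contracted copy.\<close>
lemma necklace_avoids_inside_piece:
  assumes k: "k \<in> {1..n}"
  shows "F \<inter> inside (f k ` F) = {}"
proof (rule ccontr)
  assume *: "F \<inter> inside (f k ` F) \<noteq> {}"
  define A where "A = f k ` F"
  define C where "C = (\<Union>j\<in>{1..n}-{k}. f j ` F - f k ` F)"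
  have "C = (\<Union>j\<in>{1..n}-{k}. f j ` F) - A"
    unfolding A_def C_def by (simp only: UN_simps)
  then have F: "F = A \<union> C"
    using necklace_split[OF N k] unfolding A_def by (simp only: Un_Diff_cancel)
  have "connected C"
    unfolding C_def by (rule other_pieces_connected[OF k])
  have "compact A" unfolding A_def by (rule necklace_piece[OF N k])
  then have "open (inside A)" "open (outside A)"
    by (simp_all add: open_inside open_outside compact_imp_closed)
  moreover have "C \<subseteq> inside A \<union> outside A"
    unfolding inside_Un_outside A_def C_def by (simp only: UN_simps) blast
  moreover have "C \<inter> inside A \<noteq> {}"
    using * F inside_no_overlap[of A] unfolding A_def by blast
  ultimately have "C \<inter> outside A = {}"
    using \<open>connected C\<close> inside_Int_outside[of A] unfolding connected_def by blast
  then have "F \<inter> outside A = {}"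
    using F outside_no_overlap[of A] by blast
  then have "outside A \<subseteq> outside F"
    using outside_Un_outside_Un[of F A "{}"] F by (simp add: Un_absorb1 Un_commute)
  moreover have "outside F \<subseteq> outside A"
    by (rule outside_mono) (use F in blast)
  ultimately have out: "outside A = outside F" by blast
  \<comment> \<open>\<open>H\<close> is \<open>F\<close> with its holes filled in; \<open>f k\<close> maps it onto itself because \<open>f k\<close> commutes
    with \<^const>\<open>outside\<close>.\<close>
  define H where "H = - outside F"
  obtain g where g: "homeomorphism UNIV UNIV (f k) g"
    using necklace_homeomorphism[OF N k] .
  have H: "f k ` H = H"
    using outside_homeomorphism_image[OF g, of F] out homeomorphism_bij[OF g]
    unfolding A_def H_def by (simp add: bij_image_Compl_eq)
  have "bounded F" "F \<noteq> {}"
    using necklace_attractor(1,2)[OF N] by (simp_all add: compact_imp_bounded)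
  then have "bounded H"
    unfolding H_def by (simp add: cobounded_outside)
  have "F \<subseteq> H" unfolding H_def using outside_no_overlap[of F] by blast
  obtain c where c: "c < 1" "0 < c" "\<And>x y. dist (f k x) (f k y) \<le> c * dist x y"
    using N k unfolding fractal_necklace_def contractive_def by blast
  have "diameter H \<le> c * diameter H"
  proof (rule diameter_le)
    show "H \<noteq> {} \<or> 0 \<le> c * diameter H" using \<open>F \<subseteq> H\<close> \<open>F \<noteq> {}\<close> by blast
    fix x y assume "x \<in> H" "y \<in> H"
    then obtain x' y' where xy: "x' \<in> H" "y' \<in> H" "x = f k x'" "y = f k y'"
      using H by (metis imageE)
    have "dist x y \<le> c * dist x' y'" using c xy by simp
    also have "\<dots> \<le> c * diameter H"
      using c diameter_bounded_bound[OF \<open>bounded H\<close> xy(1,2)] by simp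
    finally show "norm (x - y) \<le> c * diameter H" by (simp add: dist_norm)
  qed
  then have "(1 - c) * diameter H \<le> 0" by (simp add: algebra_simps)
  then have "diameter H \<le> 0" using c by (simp add: mult_le_0_iff)
  have "x = y" if "x \<in> F" "y \<in> F" for x y
  proof -
    have "dist x y \<le> diameter H"
      by (rule diameter_bounded_bound[OF \<open>bounded H\<close>]) (use that \<open>F \<subseteq> H\<close> in auto)
    then have "dist x y \<le> 0" using \<open>diameter H \<le> 0\<close> by linarith
    then show ?thesis by simp
  qed
  then have "is_singleton F"
    using \<open>F \<noteq> {}\<close> by (rule is_singletonI'[rotated])
  then show False
    using nontrivial by contradiction
qed

text \<open>The first bead meets the second and the last in different points, so its intersection with the
  union of the other beads is finite with at least two points. If \<open>F\<close> had a connected complement,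
  Janiszewski's theorem would make this intersection connected.\<close>
lemma necklace_inside_nonempty: "inside F \<noteq> {}"
proof
  assume empty: "inside F = {}"
  have n: "3 \<le> n" and one: "1 \<in> {1..n}" using necklace_attractor(4)[OF N] by auto
  define A where "A = f 1 ` F"
  define B where "B = (\<Union>j\<in>{1..n}-{1}. f j ` F)"
  have F: "F = A \<union> B"
    unfolding A_def B_def by (rule necklace_split[OF N one])
  have "connected A" "connected B"
    unfolding A_def B_def by (rule piece_connected[OF one], rule other_pieces_connected[OF one])
  have "compact A" unfolding A_def by (rule necklace_piece[OF N one])
  have "compact B" unfolding B_def by (rule compact_UN) (auto intro: necklace_piece[OF N])
  have "bounded F" using necklace_attractor(2)[OF N] by (rule compact_imp_bounded)
  then have "connected (outside F)" by (simp add: connected_outside)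
  then have "connected (- (A \<union> B))"
    using empty F by (metis inside_Un_outside sup_bot_left)
  then have conn: "connected (A \<inter> B)"
    using Janiszewski_dual_plane[of A B] \<open>compact A\<close> \<open>compact B\<close> \<open>connected A\<close> \<open>connected B\<close>
    by simp
  have "finite (f 1 ` F \<inter> f j ` F)" if "j \<in> {1..n} - {1}" for j
    using necklace_meet_cases[OF N one, of j] that by auto
  moreover have "A \<inter> B = (\<Union>j\<in>{1..n}-{1}. f 1 ` F \<inter> f j ` F)"
    unfolding A_def B_def by (rule Int_UN_distrib)
  ultimately have "finite (A \<inter> B)"
    by (simp only:) (rule finite_UN_I, auto)
  obtain p where p: "f 1 ` F \<inter> f 2 ` F = {p}"
    using necklace_adjacent[OF N, of 1 2] n by auto
  obtain q where q: "f 1 ` F \<inter> f n ` F = {q}"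
    using necklace_adjacent[OF N, of 1 n] n by auto
  have "p \<noteq> q"
    using no_triple_point[of 1 2 n] p q n by auto
  moreover have "2 \<in> {1..n} - {1}" "n \<in> {1..n} - {1}" using n by auto
  then have "p \<in> A \<inter> B" "q \<in> A \<inter> B"
    using p q unfolding A_def B_def Int_UN_distrib by (metis UN_I insertI1)+
  ultimately show False
    using connected_finite_iff_sing[OF conn] \<open>finite (A \<inter> B)\<close> by (metis empty_iff singletonD)
qed

lemma inside_necklace_open_set:
  shows "bounded (inside F)" "open (inside F)"
    and "k \<in> {1..n} \<Longrightarrow> f k ` inside F = inside (f k ` F)"
    and "k \<in> {1..n} \<Longrightarrow> inside (f k ` F) \<subseteq> inside F"
    and "disjoint_family_on (\<lambda>k. inside (f k ` F)) {1..n}"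
proof -
  show "bounded (inside F)" "open (inside F)"
    using necklace_attractor(2)[OF N]
    by (simp_all add: bounded_inside open_inside compact_imp_bounded compact_imp_closed)
  show "f k ` inside F = inside (f k ` F)" if k: "k \<in> {1..n}"
    using necklace_homeomorphism[OF N k] inside_homeomorphism_image by metis
  show "inside (f k ` F) \<subseteq> inside F" if "k \<in> {1..n}"
    using inside_mono[OF necklace_piece(2)[OF N that]] necklace_avoids_inside_piece[OF that]
    by blast
  show "disjoint_family_on (\<lambda>k. inside (f k ` F)) {1..n}"
    unfolding disjoint_family_on_def
  proof (intro ballI impI)
    fix m k assume mk: "m \<in> {1..n}" "k \<in> {1..n}" "m \<noteq> k"
    show "inside (f m ` F) \<inter> inside (f k ` F) = {}"
    proof (rule insides_disjoint)
      show "finite (f m ` F \<inter> f k ` F)"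
        using necklace_meet_cases[OF N mk] by auto
      show "f m ` F \<inter> inside (f k ` F) = {}" "f k ` F \<inter> inside (f m ` F) = {}"
        using necklace_avoids_inside_piece necklace_piece(2)[OF N] mk by blast+
    qed (use necklace_piece(1)[OF N] mk in \<open>simp_all add: compact_imp_closed\<close>)
  qed
qed

end

theorem theorem4:
  fixes n :: nat and f :: "nat \<Rightarrow> real^2 \<Rightarrow> real^2" and F :: "(real^2) set"
  assumes "fractal_necklace n f F"
    and "\<not> is_singleton F"
    and "\<nexists>x. cut_point F x"
  shows "open_set_condition n f"
proof -
  note V = inside_necklace_open_set[OF assms]
  have "open (f k ` inside F) \<and> f k ` inside F \<subseteq> inside F" if "k \<in> {1..n}" for k
    using V(3,4)[OF that] necklace_piece(1)[OF assms(1) that]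
    by (simp add: open_inside compact_imp_closed)
  moreover have "disjoint_family_on (\<lambda>k. f k ` inside F) {1..n}"
    using V(3,5) by (simp add: disjoint_family_on_def)
  ultimately show ?thesis
    unfolding open_set_condition_def
    using V(1,2) necklace_inside_nonempty[OF assms] by blast
qed

end
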